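(* Let $G$ be a graph. A vertex $v\in V(G)$ is min-forced if and only if at least one of the following holds: \begin{enumerate} \item[(i)] $v$ is isolated; \item[(ii)] $\gamma^{LD}(G-v)>\gamma^{LD}(G)$; \item[(iii)] $\gamma^{LD}(G-v)=\gamma^{LD}(G)$, and for the graph $G-v$ there exists no minimum LD-code $S$ such that $I_G(S;v)\ne\emptyset$ and $I_G(S;v)\ne I_G(S;w)$ for all $w\in V(G)\setminus(S\cup\{v\})$. \end{enumerate}
   Context: All graphs are simple, finite and undirected. $G-v$ is the subgraph of $G$ induced by $V(G)\setminus\{v\}$. $N_G[v]$ denotes the closed neighbourhood of $v$, i.e. $v$ together with its neighbours. For $S\subseteq V(G)$ and $v\in V(G)$ put $I_G(S;v)=S\cap N_G[v]$. A nonempty set $S\subseteq V(G)$ is a locating-dominating code (LD-code) if for all distinct $x,y\in V(G)\setminus S$ we have $I_G(S;x)\ne I_G(S;y)$, and $I_G(S;x)\neq\emptyset$ for every $x\in V(G)\setminus S$. $\gamma^{LD}(G)$ is the minimum cardinality of an LD-code in $G$; an LD-code of this cardinality is a minimum LD-code. A vertex $v\in V(G)$ is min-forced if it belongs to every minimum LD-code of $G$. *)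

theory Defs
  imports "Graph_Theory.Digraph_Component"
begin

text \<open>
  Simple finite undirected graphs are the graphs of the locale \<^locale>\<open>graph\<close>: finite loop-free
  symmetric digraphs without parallel arcs, an edge \<open>uv\<close> being the pair of opposite arcs between
  \<open>u\<close> and \<open>v\<close>. Adjacency is \<open>u \<rightarrow>\<^bsub>G\<^esub> v\<close>, and \<open>G \<restriction> W\<close> is the induced subgraph.
\<close>

abbreviation delete_vertex :: "('a, 'b) pre_digraph \<Rightarrow> 'a \<Rightarrow> ('a, 'b) pre_digraph" where
  "delete_vertex G v \<equiv> G \<restriction> (verts G - {v})"

definition closed_neighbourhood :: "('a, 'b) pre_digraph \<Rightarrow> 'a \<Rightarrow> 'a set" where
  "closed_neighbourhood G v = insert v {u. v \<rightarrow>\<^bsub>G\<^esub> u}"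

definition isolated :: "('a, 'b) pre_digraph \<Rightarrow> 'a \<Rightarrow> bool" where
  "isolated G v \<longleftrightarrow> v \<in> verts G \<and> \<not> (\<exists>u. v \<rightarrow>\<^bsub>G\<^esub> u)"

definition I_set :: "('a, 'b) pre_digraph \<Rightarrow> 'a set \<Rightarrow> 'a \<Rightarrow> 'a set" where
  "I_set G S v = S \<inter> closed_neighbourhood G v"

definition LD_code :: "('a, 'b) pre_digraph \<Rightarrow> 'a set \<Rightarrow> bool" where
  "LD_code G S \<longleftrightarrow> S \<subseteq> verts G \<and> S \<noteq> {} \<and>
     (\<forall>x \<in> verts G - S. \<forall>y \<in> verts G - S. x \<noteq> y \<longrightarrow> I_set G S x \<noteq> I_set G S y) \<and>
     (\<forall>x \<in> verts G - S. I_set G S x \<noteq> {})"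

text \<open>
  A graph with at least one vertex has an LD-code, namely its whole vertex set. The null graph has
  none, since codes are nonempty; its \<open>\<gamma>_LD\<close> is an unspecified number.
\<close>

definition \<gamma>_LD :: "('a, 'b) pre_digraph \<Rightarrow> nat" where
  "\<gamma>_LD G = (LEAST k. \<exists>S. LD_code G S \<and> card S = k)"

definition minimum_LD_code :: "('a, 'b) pre_digraph \<Rightarrow> 'a set \<Rightarrow> bool" where
  "minimum_LD_code G S \<longleftrightarrow> LD_code G S \<and> card S = \<gamma>_LD G"

definition min_forced :: "('a, 'b) pre_digraph \<Rightarrow> 'a \<Rightarrow> bool" where
  "min_forced G v \<longleftrightarrow> v \<in> verts G \<and> (\<forall>S. minimum_LD_code G S \<longrightarrow> v \<in> S)"

end

theory Submission
  imports Defs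
begin

text \<open>
  An isolated vertex can be dominated only by itself, so it lies in every code. For the rest, the
  argument compares \<open>G\<close> with \<open>G - v\<close> through the codes that avoid \<open>v\<close>. For vertices other than
  \<open>v\<close>, and for \<open>S\<close> avoiding \<open>v\<close>, the sets \<open>I(S; x)\<close> are the same in both graphs. Hence the codes of
  \<open>G\<close> that avoid \<open>v\<close> are exactly the codes of \<open>G - v\<close> that also dominate \<open>v\<close> and distinguish it from
  all other non-code vertices (\<open>LD_code_avoiding_iff\<close>). This already shows that \<open>v\<close> is min-forced
  under (ii) or (iii), and that (iii) holds when \<open>v\<close> is min-forced and the two minima agree.

  What remains is to exclude \<open>\<gamma>_LD (G - v) < \<gamma>_LD G\<close> when \<open>v\<close> is min-forced and not isolated. Adding
  \<open>v\<close> to a minimum code of \<open>G - v\<close> would only give a code through \<open>v\<close>. Instead one can always add a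
  suitable vertex other than \<open>v\<close> (\<open>LD_code_extend_avoiding\<close>): a neighbour of \<open>v\<close> if \<open>v\<close> is not yet
  dominated, or else the single vertex that has the same \<open>I\<close>-set as \<open>v\<close>, if there is one. The resulting
  code of \<open>G\<close> has at most \<open>\<gamma>_LD (G - v) + 1 \<le> \<gamma>_LD G\<close> vertices, so it is a minimum code missing \<open>v\<close>.
\<close>

definition locates :: "('a, 'b) pre_digraph \<Rightarrow> 'a set \<Rightarrow> 'a \<Rightarrow> bool" where
  "locates G S v \<longleftrightarrow> I_set G S v \<noteq> {} \<and>
     (\<forall>w \<in> verts G - (S \<union> {v}). I_set G S v \<noteq> I_set G S w)"

lemma LD_code_iff_inj_on:
  "LD_code G S \<longleftrightarrow> S \<subseteq> verts G \<and> S \<noteq> {} \<and> inj_on (I_set G S) (verts G - S) \<and>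
     (\<forall>x \<in> verts G - S. I_set G S x \<noteq> {})"
  unfolding LD_code_def inj_on_def by meson

text \<open>
  Enlarging a code only makes \<open>I\<close>-sets finer: the old ones are recovered by intersecting with \<open>S\<close>.
\<close>

lemma LD_code_mono:
  assumes "LD_code G S" and "S \<subseteq> T" and "T \<subseteq> verts G"
  shows "LD_code G T"
proof -
  have restrict: "I_set G S x = S \<inter> I_set G T x" for x
    using assms(2) by (auto simp: I_set_def)
  show ?thesis
    unfolding LD_code_def
  proof (intro conjI ballI impI)
    show "T \<subseteq> verts G" by fact
    show "T \<noteq> {}" using assms(1,2) by (auto simp: LD_code_def)
  next
    fix x y assume "x \<in> verts G - T" "y \<in> verts G - T" "x \<noteq> y"
    then have "I_set G S x \<noteq> I_set G S y"
      using assms(1,2) unfolding LD_code_def by blast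
    then show "I_set G T x \<noteq> I_set G T y"
      by (auto simp: restrict)
  next
    fix x assume "x \<in> verts G - T"
    then have "I_set G S x \<noteq> {}"
      using assms(1,2) by (auto simp: LD_code_def)
    then show "I_set G T x \<noteq> {}" by (auto simp: restrict)
  qed
qed

lemma \<gamma>_LD_le: "LD_code G S \<Longrightarrow> \<gamma>_LD G \<le> card S"
  unfolding \<gamma>_LD_def by (rule Least_le) blast

lemma minimum_LD_code_exists:
  assumes "verts G \<noteq> {}"
  obtains S where "minimum_LD_code G S"
proof -
  have "LD_code G (verts G)"
    using assms by (simp add: LD_code_def)
  then have "\<exists>k S. LD_code G S \<and> card S = k" by blast
  then have "\<exists>S. LD_code G S \<and> card S = \<gamma>_LD G"
    unfolding \<gamma>_LD_def by (rule LeastI_ex)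
  then show thesis using that by (auto simp: minimum_LD_code_def)
qed

lemma LD_code_contains_isolated:
  assumes "LD_code G S" and "isolated G v"
  shows "v \<in> S"
proof (rule ccontr)
  assume "v \<notin> S"
  then have "I_set G S v = {}"
    using assms(2) by (auto simp: I_set_def closed_neighbourhood_def isolated_def)
  then show False
    using assms \<open>v \<notin> S\<close> by (auto simp: LD_code_def isolated_def)
qed

lemma I_set_delete_vertex:
  assumes "S \<subseteq> verts G - {v}" and "x \<in> verts G - {v}"
  shows "I_set (delete_vertex G v) S x = I_set G S x"
  using assms
  by (auto simp: I_set_def closed_neighbourhood_def arcs_ends_def arc_to_ends_def
      induce_subgraph_def)

text \<open>
  Passing from \<open>G - v\<close> to \<open>G\<close> adds \<open>v\<close> to the non-code vertices and changes no other \<open>I\<close>-set, so the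
  only new requirements are those that mention \<open>v\<close>.
\<close>

lemma LD_code_avoiding_iff:
  assumes "v \<in> verts G" and "v \<notin> S"
  shows "LD_code G S \<longleftrightarrow> LD_code (delete_vertex G v) S \<and> locates G S v"
proof (cases "S \<subseteq> verts G - {v}")
  case True
  have verts_split: "verts G - S = insert v (verts G - {v} - S)"
    using assms by auto
  have eq: "I_set (delete_vertex G v) S x = I_set G S x" if "x \<in> verts G - {v} - S" for x
    using I_set_delete_vertex[OF True] that by blast
  let ?R = "verts G - {v} - S"
  have "inj_on (I_set (delete_vertex G v) S) ?R \<longleftrightarrow> inj_on (I_set G S) ?R"
    by (rule inj_on_cong) (rule eq)
  moreover have "(\<forall>x \<in> ?R. I_set (delete_vertex G v) S x \<noteq> {}) \<longleftrightarrow> (\<forall>x \<in> ?R. I_set G S x \<noteq> {})"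
    by (simp add: eq)
  ultimately have "LD_code (delete_vertex G v) S \<longleftrightarrow> S \<noteq> {} \<and>
      inj_on (I_set G S) ?R \<and> (\<forall>x \<in> ?R. I_set G S x \<noteq> {})"
    using True by (simp add: LD_code_iff_inj_on)
  moreover have "LD_code G S \<longleftrightarrow> S \<noteq> {} \<and> inj_on (I_set G S) ?R \<and>
      I_set G S v \<notin> I_set G S ` ?R \<and> I_set G S v \<noteq> {} \<and> (\<forall>x \<in> ?R. I_set G S x \<noteq> {})"
  proof -
    have "S \<subseteq> verts G" "?R - {v} = ?R" using True by blast+
    then show ?thesis
      by (simp only: LD_code_iff_inj_on verts_split inj_on_insert ball_simps simp_thms conj_assoc)
  qed
  moreover have "locates G S v \<longleftrightarrow> I_set G S v \<noteq> {} \<and> I_set G S v \<notin> I_set G S ` ?R"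
  proof -
    have "verts G - (S \<union> {v}) = ?R" by blast
    then show ?thesis by (simp only: locates_def image_iff bex_simps ball_simps)
  qed
  ultimately show ?thesis by argo
next
  case False
  then show ?thesis using assms by (auto simp: LD_code_def)
qed

text \<open>
  The two possible additions cannot create a new conflict with \<open>v\<close>. If \<open>v\<close> is undominated, then after
  adding a neighbour \<open>u\<close> its \<open>I\<close>-set is \<open>{u}\<close>, whereas every other non-code vertex still sees an old
  code vertex. If \<open>v\<close> shares its \<open>I\<close>-set with \<open>w\<close>, then no third vertex does, because \<open>S\<close> separates
  the vertices of \<open>G - v\<close>; so placing \<open>w\<close> into the code removes the only conflict.
\<close>

lemma LD_code_extend_avoiding:
  assumes "graph G" and "v \<in> verts G" and "\<not> isolated G v"
    and code: "LD_code (delete_vertex G v) S"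
  obtains T where "LD_code G T" and "v \<notin> T" and "card T \<le> Suc (card S)"
proof -
  interpret graph G by fact
  have S: "S \<subseteq> verts G - {v}"
    using code by (auto simp: LD_code_def)
  have separated: "x = y" if "x \<in> verts G - {v} - S" "y \<in> verts G - {v} - S"
      "I_set G S x = I_set G S y" for x y
    using code that I_set_delete_vertex[OF S] by (auto simp: LD_code_def)
  have dominated: "I_set G S x \<noteq> {}" if "x \<in> verts G - {v} - S" for x
    using code that I_set_delete_vertex[OF S] by (auto simp: LD_code_def)
  have restrict: "I_set G S x = S \<inter> I_set G (insert a S) x" for a x
    by (auto simp: I_set_def)
  \<comment> \<open>One added vertex, provided it leaves \<open>v\<close> dominated and distinguished, is all that is needed;
      \<open>LD_code_mono\<close> takes care of the conditions at the other vertices.\<close>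
  note found = that
  have add: thesis if a: "a \<in> verts G - {v}" and "locates G (insert a S) v" for a
  proof (rule found)
    have "LD_code (delete_vertex G v) (insert a S)"
      using LD_code_mono[OF code, of "insert a S"] S a by (auto simp: induce_subgraph_def)
    then show "LD_code G (insert a S)"
      using LD_code_avoiding_iff[OF assms(2), of "insert a S"] that S
      by blast
    show "v \<notin> insert a S" using S a by auto
    show "card (insert a S) \<le> Suc (card S)" by (rule card_insert_le_m1) auto
  qed
  consider (located) "locates G S v"
    | (undominated) "I_set G S v = {}"
    | (twin) w where "I_set G S v \<noteq> {}" "w \<in> verts G - {v} - S" "I_set G S v = I_set G S w"
    by (auto simp: locates_def)
  then show thesis
  proof cases
    case located
    then have "LD_code G S"
      using LD_code_avoiding_iff[OF assms(2)] S code by blast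
    then show thesis using found[of S] S by auto
  next
    case undominated
    from assms(2,3) obtain u where u: "v \<rightarrow>\<^bsub>G\<^esub> u"
      by (auto simp: isolated_def)
    have u_vert: "u \<in> verts G - {v}"
      using adj_in_verts(2)[OF u] adj_not_same[of v] u by auto
    have "I_set G (insert u S) v = {u}"
      using undominated u by (auto simp: I_set_def closed_neighbourhood_def)
    moreover have "u \<notin> S"
      using undominated u by (auto simp: I_set_def closed_neighbourhood_def)
    ultimately have "I_set G (insert u S) v \<noteq> I_set G (insert u S) w"
      if "w \<in> verts G - (insert u S \<union> {v})" for w
      using dominated[of w] that restrict[of w u] by auto
    then have "locates G (insert u S) v"
      using \<open>I_set G (insert u S) v = {u}\<close> by (auto simp: locates_def)
    then show thesis by (rule add[OF u_vert])
  next
    case twin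
    have "I_set G (insert w S) v \<noteq> I_set G (insert w S) x"
      if "x \<in> verts G - (insert w S \<union> {v})" for x
      using separated[of x w] that twin restrict[of v w] restrict[of x w] by auto
    moreover have "I_set G (insert w S) v \<noteq> {}"
      using twin(1) restrict[of v w] by auto
    ultimately have "locates G (insert w S) v"
      by (simp add: locates_def)
    then show thesis using add twin(2) by blast
  qed
qed

theorem theorem2p1:
  fixes G :: "('a, 'b) pre_digraph" and v :: 'a
  assumes "graph G" and "v \<in> verts G"
  shows "min_forced G v \<longleftrightarrow>
    isolated G v \<or>
    \<gamma>_LD (delete_vertex G v) > \<gamma>_LD G \<or>
    (\<gamma>_LD (delete_vertex G v) = \<gamma>_LD G \<and>
     \<not> (\<exists>S. minimum_LD_code (delete_vertex G v) S \<and>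
            I_set G S v \<noteq> {} \<and>
            (\<forall>w \<in> verts G - (S \<union> {v}). I_set G S v \<noteq> I_set G S w)))"
proof -
  let ?H = "delete_vertex G v"
  have "min_forced G v \<longleftrightarrow> isolated G v \<or> \<gamma>_LD ?H > \<gamma>_LD G \<or>
    (\<gamma>_LD ?H = \<gamma>_LD G \<and> \<not> (\<exists>S. minimum_LD_code ?H S \<and> locates G S v))"
    (is "_ \<longleftrightarrow> _ \<or> ?gt \<or> ?eq")
  proof (cases "isolated G v")
    case True
    then show ?thesis
      using LD_code_contains_isolated assms(2)
      by (auto simp: min_forced_def minimum_LD_code_def)
  next
    case False
    have "min_forced G v \<longleftrightarrow> ?gt \<or> ?eq"
    proof
      assume forced: "min_forced G v"
      interpret graph G by fact
      obtain u where "v \<rightarrow>\<^bsub>G\<^esub> u" using False assms(2) by (auto simp: isolated_def)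
      then have "u \<in> verts ?H" using adj_in_verts(2) adj_not_same[of v] by auto
      then have "verts ?H \<noteq> {}" by blast
      then obtain S where S: "minimum_LD_code ?H S"
        by (rule minimum_LD_code_exists)
      then have "LD_code ?H S" by (simp add: minimum_LD_code_def)
      then obtain T where T: "LD_code G T" "v \<notin> T" "card T \<le> Suc (card S)"
        by (rule LD_code_extend_avoiding[OF assms False])
      have "card T \<noteq> \<gamma>_LD G"
        using forced T(1,2) by (auto simp: min_forced_def minimum_LD_code_def)
      then have "\<gamma>_LD G < card T"
        using \<gamma>_LD_le[OF T(1)] by linarith
      then have "\<gamma>_LD G \<le> \<gamma>_LD ?H"
        using T(3) S by (simp add: minimum_LD_code_def)
      moreover have "\<not> (\<exists>S. minimum_LD_code ?H S \<and> locates G S v)" if "\<gamma>_LD ?H = \<gamma>_LD G"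
      proof
        assume "\<exists>S. minimum_LD_code ?H S \<and> locates G S v"
        then obtain S where S: "LD_code ?H S" "card S = \<gamma>_LD G" "locates G S v"
          using \<open>\<gamma>_LD ?H = \<gamma>_LD G\<close> by (auto simp: minimum_LD_code_def)
        then have "v \<notin> S" by (auto simp: LD_code_def)
        with S have "minimum_LD_code G S"
          using LD_code_avoiding_iff[OF assms(2)] by (auto simp: minimum_LD_code_def)
        then show False using forced \<open>v \<notin> S\<close> by (auto simp: min_forced_def)
      qed
      ultimately show "?gt \<or> ?eq" by (metis le_neq_implies_less)
    next
      assume cond: "?gt \<or> ?eq"
      have False if S: "minimum_LD_code G S" and "v \<notin> S" for S
      proof -
        have *: "LD_code ?H S" "locates G S v"
          using LD_code_avoiding_iff[OF assms(2) \<open>v \<notin> S\<close>] S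
          by (auto simp: minimum_LD_code_def)
        then have "\<gamma>_LD ?H \<le> \<gamma>_LD G"
          using \<gamma>_LD_le[OF *(1)] S by (simp add: minimum_LD_code_def)
        then show False
          using cond * S by (auto simp: minimum_LD_code_def)
      qed
      then show "min_forced G v"
        using assms(2) by (auto simp: min_forced_def)
    qed
    then show ?thesis using False by simp
  qed
  then show ?thesis unfolding locates_def .
qed

end
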